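(* Let $F$ be a forest of order $n\geq 1$. Then $$Q(F)\leq \frac{1}{3}\left(n-1\right).$$ Equality is reached for $F\in \{P_1,P_2\}$.
   Context: All graphs are finite and simple. For a graph $G$ and an integer $k\ge 0$, $\sigma_k(G)$ denotes the number of subsets $A\subseteq V(G)$ such that the subgraph of $G$ induced by $A$ has exactly $k$ edges. Thus $\sigma_0(G)$ is the number of independent vertex subsets of $G$ (including the empty set), and $\sigma_1(G)$ is the number of vertex subsets inducing exactly one edge. The ratio is $Q(G)=\sigma_1(G)/\sigma_0(G)$. The order of a graph is its number of vertices. $P_n$ denotes the path with $n$ vertices. *)

theory Defs
  imports Complex_Main
begin

text \<open>A graph is a pair of a vertex set and a set of edges, an edge being a two-element set of
  vertices.\<close>

type_synonym 'a sgraph = "'a set \<times> 'a set set"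

abbreviation verts :: "'a sgraph \<Rightarrow> 'a set" where
  "verts \<equiv> fst"

abbreviation edges :: "'a sgraph \<Rightarrow> 'a set set" where
  "edges \<equiv> snd"

definition finite_simple_graph :: "'a sgraph \<Rightarrow> bool" where
  "finite_simple_graph G \<longleftrightarrow> finite (verts G) \<and> (\<forall>e\<in>edges G. e \<subseteq> verts G \<and> card e = 2)"

definition order :: "'a sgraph \<Rightarrow> nat" where
  "order G = card (verts G)"

definition induced_subgraph :: "'a sgraph \<Rightarrow> 'a set \<Rightarrow> 'a sgraph" where
  "induced_subgraph G A = (A, {e \<in> edges G. e \<subseteq> A})"

definition sigma :: "nat \<Rightarrow> 'a sgraph \<Rightarrow> nat" where
  "sigma k G = card {A. A \<subseteq> verts G \<and> card (edges (induced_subgraph G A)) = k}"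

definition Q_ratio :: "'a sgraph \<Rightarrow> real" where
  "Q_ratio G = real (sigma 1 G) / real (sigma 0 G)"

text \<open>A cycle is given by the list of its vertices in cyclic order, the first vertex not being
  repeated at the end.\<close>

definition is_cycle :: "'a sgraph \<Rightarrow> 'a list \<Rightarrow> bool" where
  "is_cycle G xs \<longleftrightarrow> 3 \<le> length xs \<and> distinct xs \<and>
     (\<forall>i<length xs. {xs ! i, xs ! (Suc i mod length xs)} \<in> edges G)"

definition forest :: "'a sgraph \<Rightarrow> bool" where
  "forest G \<longleftrightarrow> finite_simple_graph G \<and> (\<nexists>xs. is_cycle G xs)"

definition path_graph :: "nat \<Rightarrow> nat sgraph" where
  "path_graph n = ({0..<n}, {{i, Suc i} |i. Suc i < n})"

definition isomorphic :: "'a sgraph \<Rightarrow> 'b sgraph \<Rightarrow> bool" where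
  "isomorphic G H \<longleftrightarrow> (\<exists>f. bij_betw f (verts G) (verts H) \<and>
     (\<forall>u\<in>verts G. \<forall>v\<in>verts G. {u, v} \<in> edges G \<longleftrightarrow> {f u, f v} \<in> edges H))"

end

theory Submission
  imports Defs
begin

text \<open>
  The bound splits into a statement about all graphs and one about forests.

  In any graph with \<open>m\<close> edges, \<open>3 \<sigma>\<^sub>1 \<le> m \<sigma>\<^sub>0\<close>. Indeed, classify the vertex sets inducing exactly one edge
  by that edge. If \<open>A\<close> induces only the edge \<open>uv\<close>, then \<open>A - {u, v}\<close>, \<open>A - {u}\<close> and \<open>A - {v}\<close>
  are three independent sets, told apart by how they meet \<open>{u, v}\<close>, and each of them
  determines \<open>A\<close> once \<open>uv\<close> is known. So every edge accounts for at most a third of \<open>\<sigma>\<^sub>0\<close>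
  (\<open>single_edge_sets_le\<close>, \<open>sigma_1_le\<close>).

  A forest of order \<open>n \<ge> 1\<close> has at most \<open>n - 1\<close> edges, because it always has a vertex of degree
  at most one to remove (\<open>forest_has_vertex_of_degree_le_1\<close>, \<open>forest_card_edges\<close>).

  For \<open>P\<^sub>1\<close> the bound is \<open>0\<close> and hence attained, as ratios are not negative. In \<open>P\<^sub>2\<close> three of the
  four vertex sets are independent and the fourth induces the edge, so the ratio is \<open>1/3\<close>.
\<close>

lemma finite_edges:
  assumes "finite_simple_graph G"
  shows "finite (edges G)"
proof -
  have "edges G \<subseteq> Pow (verts G)"
    using assms by (auto simp: finite_simple_graph_def)
  moreover have "finite (Pow (verts G))"
    using assms by (simp add: finite_simple_graph_def)
  ultimately show ?thesis by (rule finite_subset)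
qed

text \<open>Finiteness of the edge set matters here: an infinite induced edge set would also have
  cardinality 0.\<close>

lemma sigma_0_eq:
  assumes "finite_simple_graph G"
  shows "sigma 0 G = card {A. A \<subseteq> verts G \<and> {e \<in> edges G. e \<subseteq> A} = {}}"
  using finite_edges[OF assms] by (simp add: sigma_def induced_subgraph_def)

lemma sigma_1_eq:
  "sigma 1 G = card (\<Union>d\<in>edges G. {A. A \<subseteq> verts G \<and> {e \<in> edges G. e \<subseteq> A} = {d}})"
proof -
  have "{A. A \<subseteq> verts G \<and> card (edges (induced_subgraph G A)) = 1}
      = (\<Union>d\<in>edges G. {A. A \<subseteq> verts G \<and> {e \<in> edges G. e \<subseteq> A} = {d}})"
  proof (intro equalityI subsetI)
    fix A
    assume "A \<in> {A. A \<subseteq> verts G \<and> card (edges (induced_subgraph G A)) = 1}"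
    hence "A \<subseteq> verts G" "card {e \<in> edges G. e \<subseteq> A} = 1"
      by (simp_all add: induced_subgraph_def)
    moreover from this(2) obtain d where "{e \<in> edges G. e \<subseteq> A} = {d}"
      by (rule card_1_singletonE)
    ultimately have "A \<subseteq> verts G" "{e \<in> edges G. e \<subseteq> A} = {d}" by blast+
    thus "A \<in> (\<Union>d\<in>edges G. {A. A \<subseteq> verts G \<and> {e \<in> edges G. e \<subseteq> A} = {d}})"
      by blast
  qed (auto simp: induced_subgraph_def)
  thus ?thesis by (simp add: sigma_def)
qed

lemma sigma_0_pos:
  assumes "finite_simple_graph G"
  shows "sigma 0 G > 0"
proof -
  have "{} \<in> {A. A \<subseteq> verts G \<and> {e \<in> edges G. e \<subseteq> A} = {}}"
    using assms by (force simp: finite_simple_graph_def)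
  moreover have "finite {A. A \<subseteq> verts G \<and> {e \<in> edges G. e \<subseteq> A} = {}}"
    using assms by (simp add: finite_simple_graph_def)
  ultimately show ?thesis
    unfolding sigma_0_eq[OF assms] card_gt_0_iff by blast
qed

text \<open>Deleting from \<open>A\<close> both ends, or either end, of its only edge gives three injections into the
  independent sets. Their images are disjoint, since they consist of sets containing neither end,
  only \<open>v\<close>, and only \<open>u\<close>, respectively.\<close>

lemma single_edge_sets_le:
  assumes G: "finite_simple_graph G" and d: "d \<in> edges G"
  shows "3 * card {A. A \<subseteq> verts G \<and> {e \<in> edges G. e \<subseteq> A} = {d}} \<le> sigma 0 G"
proof -
  obtain u v where uv: "d = {u, v}" "u \<noteq> v"
    using G d by (auto simp: finite_simple_graph_def card_2_iff)
  define S where "S = {A. A \<subseteq> verts G \<and> {e \<in> edges G. e \<subseteq> A} = {d}}"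
  define I where "I = {A. A \<subseteq> verts G \<and> {e \<in> edges G. e \<subseteq> A} = {}}"
  have fin: "finite S" "finite I"
    using G by (auto simp: S_def I_def finite_simple_graph_def)
  have ends: "u \<in> A" "v \<in> A" if "A \<in> S" for A
    using that uv by (auto simp: S_def)
  have indep: "A - X \<in> I" if "A \<in> S" "X \<inter> d \<noteq> {}" for A X
  proof -
    have A: "A \<subseteq> verts G" "{e \<in> edges G. e \<subseteq> A} = {d}"
      using that(1) by (auto simp only: S_def mem_Collect_eq)
    have False if e: "e \<in> edges G" "e \<subseteq> A - X" for e
    proof -
      have "e \<in> {e \<in> edges G. e \<subseteq> A}" using e by blast
      hence "e = d" unfolding A(2) by simp
      thus False using e(2) \<open>X \<inter> d \<noteq> {}\<close> by blast
    qed
    thus ?thesis using A(1) by (auto simp only: I_def mem_Collect_eq)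
  qed
  have inj: "inj_on (\<lambda>A. A - X) S" if "X \<subseteq> {u, v}" for X
  proof (rule inj_on_inverseI)
    fix A assume "A \<in> S"
    thus "(A - X) \<union> {u, v} = A"
      using ends[of A] that by auto
  qed
  let ?im = "\<lambda>X. (\<lambda>A. A - X) ` S"
  have card_im: "card (?im X) = card S" if "X \<subseteq> {u, v}" for X
    using inj[OF that] by (rule card_image)
  have "card (?im {u, v} \<union> (?im {u} \<union> ?im {v}))
      = card (?im {u, v}) + (card (?im {u}) + card (?im {v}))"
  proof -
    have "?im {u} \<inter> ?im {v} = {}" "?im {u, v} \<inter> (?im {u} \<union> ?im {v}) = {}"
      using ends uv(2) by auto
    thus ?thesis
      using fin by (simp add: card_Un_disjoint)
  qed
  also have "\<dots> = 3 * card S"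
    using card_im[of "{u, v}"] card_im[of "{u}"] card_im[of "{v}"] by simp
  finally have "3 * card S = card (?im {u, v} \<union> (?im {u} \<union> ?im {v}))" ..
  also have "\<dots> \<le> card I"
    using indep uv by (intro card_mono fin) auto
  finally show ?thesis
    unfolding sigma_0_eq[OF G] S_def I_def .
qed

lemma sigma_1_le:
  assumes G: "finite_simple_graph G"
  shows "3 * sigma 1 G \<le> card (edges G) * sigma 0 G"
proof -
  have "3 * sigma 1 G \<le> 3 * (\<Sum>d\<in>edges G. card {A. A \<subseteq> verts G \<and> {e \<in> edges G. e \<subseteq> A} = {d}})"
    unfolding sigma_1_eq using card_UN_le[OF finite_edges[OF G]] by (rule mult_le_mono2)
  also have "\<dots> \<le> (\<Sum>d\<in>edges G. sigma 0 G)"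
    unfolding sum_distrib_left by (rule sum_mono) (rule single_edge_sets_le[OF G])
  finally show ?thesis by simp
qed

text \<open>Take a longest path, starting at \<open>x\<close>. If \<open>x\<close> had two edges, one of them would not be the first
  edge of the path; by maximality its other end is on the path again, and this closes a cycle.\<close>

lemma forest_has_vertex_of_degree_le_1:
  assumes G: "forest G" and ne: "verts G \<noteq> {}"
  shows "\<exists>v\<in>verts G. card {e \<in> edges G. v \<in> e} \<le> 1"
proof (rule ccontr)
  assume contra: "\<not> ?thesis"
  have fs: "finite_simple_graph G" and acyclic: "\<And>xs. \<not> is_cycle G xs"
    using G by (auto simp: forest_def)
  define path where "path = (\<lambda>xs. xs \<noteq> [] \<and> distinct xs \<and> set xs \<subseteq> verts G \<and>
    (\<forall>i. Suc i < length xs \<longrightarrow> {xs ! i, xs ! Suc i} \<in> edges G))"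
  have bounded: "\<forall>ys. path ys \<longrightarrow> length ys < Suc (card (verts G))"
  proof (intro allI impI)
    fix ys assume "path ys"
    hence "length ys = card (set ys)" "set ys \<subseteq> verts G"
      by (auto simp: path_def distinct_card)
    thus "length ys < Suc (card (verts G))"
      using fs by (simp add: finite_simple_graph_def card_mono less_Suc_eq_le)
  qed
  obtain x0 where "x0 \<in> verts G" using ne by blast
  hence "path [x0]" by (simp add: path_def)
  from ex_has_greatest_nat[of path, OF this bounded]
  obtain xs where xs: "path xs" and longest: "\<And>ys. path ys \<Longrightarrow> length ys \<le> length xs"
    by blast
  define x where "x = xs ! 0"
  have x: "x \<in> verts G" using xs by (auto simp: x_def path_def)
  \<comment> \<open>A path with a single vertex has no first edge; then \<open>xs ! 1\<close> is an arbitrary value, which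
    is harmless: the other end of \<open>e\<close> differs from \<open>x\<close>, hence is not on that path.\<close>
  obtain e where e: "e \<in> edges G" "x \<in> e" "e \<noteq> {x, xs ! 1}"
  proof -
    have "\<not> {e \<in> edges G. x \<in> e} \<subseteq> {{x, xs ! 1}}"
      using contra x card_mono[of "{{x, xs ! 1}}" "{e \<in> edges G. x \<in> e}"] by auto
    thus ?thesis using that by blast
  qed
  have e2: "card e = 2" "e \<subseteq> verts G" using fs e(1) by (auto simp: finite_simple_graph_def)
  then obtain w where w: "e = {x, w}" "w \<noteq> x"
    using e(2) by (metis card_2_iff doubleton_eq_iff insert_iff singletonD)
  have "w \<in> set xs"
  proof (rule ccontr)
    assume "w \<notin> set xs"
    moreover have "{(w # xs) ! i, (w # xs) ! Suc i} \<in> edges G" if "Suc i < length (w # xs)" for i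
      using that xs e(1) w(1) by (cases i) (auto simp: path_def x_def insert_commute)
    ultimately have "path (w # xs)"
      using xs e2 w(1) by (auto simp: path_def)
    from longest[OF this] show False by simp
  qed
  then obtain j where j: "j < length xs" "w = xs ! j" by (auto simp: in_set_conv_nth)
  have "j \<noteq> 0" using j w(2) by (metis x_def)
  moreover have "j \<noteq> 1" using e(3) w(1) j by auto
  ultimately have j2: "2 \<le> j" by simp
  have len: "length (take (Suc j) xs) = Suc j" using j by simp
  have "is_cycle G (take (Suc j) xs)"
    unfolding is_cycle_def
  proof (intro conjI allI impI)
    show "3 \<le> length (take (Suc j) xs)" using j j2 by simp
    show "distinct (take (Suc j) xs)" using xs by (simp add: path_def)
    fix i assume "i < length (take (Suc j) xs)"
    hence "i \<le> j" using j by simp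
    show "{take (Suc j) xs ! i, take (Suc j) xs ! (Suc i mod length (take (Suc j) xs))} \<in> edges G"
    proof (cases "i = j")
      case True
      thus ?thesis
        unfolding len using j e(1) w(1) by (simp add: x_def insert_commute)
    next
      case False
      hence "i < j" using \<open>i \<le> j\<close> by simp
      thus ?thesis
        unfolding len using xs j by (simp add: path_def)
    qed
  qed
  thus False using acyclic by blast
qed

lemma forest_induced_subgraph:
  assumes "forest G" and "A \<subseteq> verts G"
  shows "forest (induced_subgraph G A)"
proof -
  have "finite_simple_graph (induced_subgraph G A)"
    using assms finite_subset[of A "verts G"]
    by (simp add: forest_def finite_simple_graph_def induced_subgraph_def)
  moreover have "is_cycle G xs" if "is_cycle (induced_subgraph G A) xs" for xs
    using that by (simp add: is_cycle_def induced_subgraph_def)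
  ultimately show ?thesis
    using assms(1) unfolding forest_def by blast
qed

lemma forest_card_edges:
  assumes "forest G" and "verts G \<noteq> {}"
  shows "card (edges G) < card (verts G)"
  using assms
proof (induction "card (verts G)" arbitrary: G rule: less_induct)
  case less
  have fs: "finite_simple_graph G" using less.prems by (simp add: forest_def)
  obtain v where v: "v \<in> verts G" "card {e \<in> edges G. v \<in> e} \<le> 1"
    using forest_has_vertex_of_degree_le_1[OF less.prems] by blast
  define H where "H = induced_subgraph G (verts G - {v})"
  have VH: "verts H = verts G - {v}" by (simp add: H_def induced_subgraph_def)
  have card_VH: "card (verts G) = Suc (card (verts H))"
    using v fs by (simp only: VH finite_simple_graph_def card_Suc_Diff1)
  have EG: "edges G = edges H \<union> {e \<in> edges G. v \<in> e}"
    using fs by (auto simp: H_def induced_subgraph_def finite_simple_graph_def)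
  show ?case
  proof (cases "verts H = {}")
    case True
    \<comment> \<open>The induction hypothesis is about nonempty graphs; here \<open>G\<close> is a single vertex.\<close>
    have "edges G = {}"
    proof (rule ccontr)
      assume "edges G \<noteq> {}"
      then obtain e where "e \<subseteq> {v}" "card e = 2"
        using fs True VH by (fastforce simp: finite_simple_graph_def)
      thus False using card_mono[of "{v}" e] by simp
    qed
    thus ?thesis using card_VH by simp
  next
    case False
    have "card (edges H) < card (verts H)"
      using False card_VH less.prems(1)
      by (intro less.hyps) (auto simp: H_def intro: forest_induced_subgraph)
    moreover have "card (edges G) \<le> card (edges H) + card {e \<in> edges G. v \<in> e}"
      using EG card_Un_le by metis
    ultimately show ?thesis using v(2) card_VH by linarith
  qed
qed

lemma Q_ratio_forest_le:
  assumes "forest F" and "verts F \<noteq> {}"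
  shows "Q_ratio F \<le> 1 / 3 * (real (order F) - 1)"
proof -
  have fs: "finite_simple_graph F" using assms by (simp add: forest_def)
  have "card (edges F) \<le> order F - 1" "1 \<le> order F"
    using forest_card_edges[OF assms] by (auto simp: order_def)
  hence "3 * sigma 1 F \<le> (order F - 1) * sigma 0 F"
    using sigma_1_le[OF fs] by (meson le_trans mult_le_mono1)
  hence "real (3 * sigma 1 F) \<le> real ((order F - 1) * sigma 0 F)"
    by (rule of_nat_mono)
  thus ?thesis
    using sigma_0_pos[OF fs] \<open>1 \<le> order F\<close>
    by (simp add: Q_ratio_def field_simps)
qed

text \<open>When all vertices together form the only edge, every proper subset of the two vertices is
  independent and the full vertex set induces one edge.\<close>

lemma Q_ratio_single_edge_ge:
  assumes fs: "finite_simple_graph G" and "order G = 2" and E: "edges G = {verts G}"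
  shows "1 / 3 \<le> Q_ratio G"
proof -
  have fin: "finite (verts G)" and card: "card (verts G) = 2"
    using fs \<open>order G = 2\<close> by (simp_all add: finite_simple_graph_def order_def)
  have "sigma 0 G \<le> card (Pow (verts G) - {verts G})"
    unfolding sigma_0_eq[OF fs] using fin E by (intro card_mono) auto
  also have "\<dots> = 3" using fin card by (simp add: card_Pow)
  finally have "sigma 0 G \<le> 3" .
  moreover have "sigma 1 G \<noteq> 0"
    unfolding sigma_1_eq using fin E by auto
  ultimately have "real (sigma 0 G) \<le> 3" "1 \<le> real (sigma 1 G)"
    by linarith+
  thus ?thesis
    using sigma_0_pos[OF fs] unfolding Q_ratio_def
    by (simp add: field_simps)
qed

lemma isomorphic_order:
  assumes "isomorphic G H"
  shows "order G = order H"
  using assms unfolding isomorphic_def order_def by (metis bij_betw_same_card)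

lemma isomorphic_path_graph_2_edges:
  assumes fs: "finite_simple_graph G" and iso: "isomorphic G (path_graph 2)"
  shows "edges G = {verts G}"
proof -
  have card: "card (verts G) = 2"
    using isomorphic_order[OF iso] by (simp add: order_def path_graph_def)
  then obtain a b where ab: "verts G = {a, b}" "a \<noteq> b"
    by (auto simp: card_2_iff)
  obtain f where "bij_betw f (verts G) (verts (path_graph 2))"
    and "\<forall>u\<in>verts G. \<forall>v\<in>verts G. {u, v} \<in> edges G \<longleftrightarrow> {f u, f v} \<in> edges (path_graph 2)"
    using iso unfolding isomorphic_def by blast
  hence f: "bij_betw f {a, b} {0..<2::nat}"
    and adj: "{a, b} \<in> edges G \<longleftrightarrow> {f a, f b} \<in> edges (path_graph 2)"
    using ab by (simp_all add: path_graph_def)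
  have "{f a, f b} = f ` {a, b}" by simp
  also have "\<dots> = {0..<2}" using f by (rule bij_betw_imp_surj_on)
  also have "\<dots> = {0, Suc 0}" by force
  also have "\<dots> \<in> edges (path_graph 2)"
    unfolding path_graph_def snd_conv by (intro CollectI exI[of _ 0]) simp
  finally have "verts G \<in> edges G"
    unfolding ab(1) adj .
  moreover have "e = verts G" if "e \<in> edges G" for e
    using that fs card card_subset_eq[of "verts G" e] by (simp add: finite_simple_graph_def)
  ultimately show ?thesis by blast
qed

theorem theorem5:
  fixes F :: "'a sgraph" and n :: nat
  assumes "forest F" and "order F = n" and "n \<ge> 1"
  shows "Q_ratio F \<le> 1 / 3 * (real n - 1) \<and>
    (isomorphic F (path_graph 1) \<or> isomorphic F (path_graph 2) \<longrightarrow>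
       Q_ratio F = 1 / 3 * (real n - 1))"
proof (intro conjI impI)
  have fs: "finite_simple_graph F" using assms(1) by (simp add: forest_def)
  have "verts F \<noteq> {}" using assms by (auto simp: order_def)
  thus bound: "Q_ratio F \<le> 1 / 3 * (real n - 1)"
    using Q_ratio_forest_le assms by blast
  assume "isomorphic F (path_graph 1) \<or> isomorphic F (path_graph 2)"
  thus "Q_ratio F = 1 / 3 * (real n - 1)"
  proof
    assume "isomorphic F (path_graph 1)"
    hence "n = 1"
      using isomorphic_order[of F "path_graph 1"] assms(2) by (simp add: order_def path_graph_def)
    moreover have "0 \<le> Q_ratio F" by (simp add: Q_ratio_def)
    ultimately show ?thesis using bound by simp
  next
    assume iso: "isomorphic F (path_graph 2)"
    have "n = 2"
      using isomorphic_order[OF iso] assms(2) by (simp add: order_def path_graph_def)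
    moreover have "1 / 3 \<le> Q_ratio F"
      using Q_ratio_single_edge_ge[OF fs] isomorphic_path_graph_2_edges[OF fs iso]
        assms(2) \<open>n = 2\<close> by simp
    ultimately show ?thesis using bound by simp
  qed
qed

end
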